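(* Let $G=P_n$ with $n\ge 4$ or $G=C_n$ with $n\ge 5$. Then $G$ does not have any pair of twin vertices, and $\beta(G[H])=n\,\beta_2(H)$ for each graph $H$. In particular: (a) for $m\ge 4$, $\beta_2(P_m)=\beta_2(C_m)=\beta_2(\overline{P}_m)=\beta_2(\overline{C}_m)=\left\lfloor\frac{2m+2}{5}\right\rfloor$, and therefore $\beta(G[P_m])=\beta(G[C_m])=\beta(G[\overline{P}_m])=\beta(G[\overline{C}_m])=n\left\lfloor\frac{2m+2}{5}\right\rfloor$; (b) $$\beta(G[\overline{K}_{m_1,m_2,\dots,m_t}])=\beta(G[K_{m_1,m_2,\dots,m_t}])=\begin{cases} n(m-r-1) & \text{if } r\neq t,\\ n(m-r) & \text{if } r=t,\end{cases}$$ where $m_1,\dots,m_r$ are at least $2$, $m_{r+1}=\cdots=m_t=1$, and $\sum_{i=1}^t m_i=m$.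
   Context: All graphs are finite and simple; $P_n$ and $C_n$ are the path and the cycle of order $n$, $K_{m_1,\dots,m_t}$ is the complete $t$-partite graph with part sizes $m_1,\dots,m_t$, a bar denotes the complement, and $u\sim v$ means adjacency. Two distinct vertices $u,v$ are twins if $N(v)\setminus\{u\}=N(u)\setminus\{v\}$, where $N(x)$ is the set of neighbors of $x$. For a connected graph $X$, an ordered set $W=\{w_1,\dots,w_k\}\subseteq V(X)$ is a resolving set if the vectors $(d_X(v,w_1),\dots,d_X(v,w_k))$, $v\in V(X)$, are pairwise distinct ($d_X$ is the graph distance); the metric dimension $\beta(X)$ is the minimum cardinality of a resolving set of $X$. For any graph $H$ and vertices $v,w$, set $a_H(v,w)=0$ if $v=w$, $a_H(v,w)=1$ if $v\sim w$, and $a_H(v,w)=2$ if $v\ne w$ and $v\nsim w$. An ordered set $W=\{w_1,\dots,w_k\}\subseteq V(H)$ is an adjacency resolving set of $H$ if the vectors $(a_H(v,w_1),\dots,a_H(v,w_k))$, $v\in V(H)$, are pairwise distinct; the adjacency metric dimension $\beta_2(H)$ is the minimum cardinality of an adjacency resolving set of $H$. The lexicographic product $G[H]$ has vertex set $V(G)\times V(H)$, with $(v,u)$ and $(v',u')$ adjacent iff $v\sim v'$ in $G$, or $v=v'$ and $u\sim u'$ in $H$.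
   Formalization: The formula for each graph H is stated for H with at least two vertices, and (b) for m ≥ 2: for H = K_1 it fails, since β_2(K_1) = 0 (or 1 if W must be nonempty) while β(P_n[K_1]) = 1 and β(C_n[K_1]) = 2. *)

theory Defs
  imports "Graph_Theory.Graph_Theory"
begin

text \<open>
  A finite simple graph is a \<^locale>\<open>pair_graph\<close>: a finite, loop-free digraph without
  parallel arcs whose arc relation is symmetric. An edge is thus a pair of opposite arcs.
\<close>

definition neighbors :: "'a pair_pre_digraph \<Rightarrow> 'a \<Rightarrow> 'a set" where
  "neighbors G v = {x. (v, x) \<in> parcs G}"

definition twins :: "'a pair_pre_digraph \<Rightarrow> 'a \<Rightarrow> 'a \<Rightarrow> bool" where
  "twins G u v \<longleftrightarrow> u \<in> pverts G \<and> v \<in> pverts G \<and> u \<noteq> v \<and>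
     neighbors G v - {u} = neighbors G u - {v}"

text \<open>The distance is the least cost of a walk when every arc has weight one.\<close>

definition gdist :: "'a pair_pre_digraph \<Rightarrow> 'a \<Rightarrow> 'a \<Rightarrow> ereal" where
  "gdist G u v = wf_digraph.\<mu> (with_proj G) (\<lambda>_. 1) u v"

definition adj_code :: "'a pair_pre_digraph \<Rightarrow> 'a \<Rightarrow> 'a \<Rightarrow> nat" where
  "adj_code H v w = (if v = w then 0 else if (v, w) \<in> parcs H then 1 else 2)"

text \<open>
  The vector of codes of \<open>v\<close> with respect to \<open>W\<close> is represented as the function on \<open>W\<close>
  giving its entries; the order in which \<open>W\<close> is listed does not affect whether two such
  vectors agree. The empty \<open>W\<close> is allowed, and resolves exactly the graphs with at most one vertex.
\<close>

definition resolving_set :: "'a pair_pre_digraph \<Rightarrow> 'a set \<Rightarrow> bool" where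
  "resolving_set G W \<longleftrightarrow>
     W \<subseteq> pverts G \<and> inj_on (\<lambda>v. restrict (gdist G v) W) (pverts G)"

definition metric_dim :: "'a pair_pre_digraph \<Rightarrow> nat" where
  "metric_dim G = (LEAST k. \<exists>W. resolving_set G W \<and> card W = k)"

definition adj_resolving_set :: "'a pair_pre_digraph \<Rightarrow> 'a set \<Rightarrow> bool" where
  "adj_resolving_set H W \<longleftrightarrow>
     W \<subseteq> pverts H \<and> inj_on (\<lambda>v. restrict (adj_code H v) W) (pverts H)"

definition adj_metric_dim :: "'a pair_pre_digraph \<Rightarrow> nat" where
  "adj_metric_dim H = (LEAST k. \<exists>W. adj_resolving_set H W \<and> card W = k)"

definition lex_product ::
  "'a pair_pre_digraph \<Rightarrow> 'b pair_pre_digraph \<Rightarrow> ('a \<times> 'b) pair_pre_digraph" where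
  "lex_product G H = \<lparr> pverts = pverts G \<times> pverts H,
     parcs = {((v, u), (v', u')).
       v \<in> pverts G \<and> u \<in> pverts H \<and> v' \<in> pverts G \<and> u' \<in> pverts H \<and>
       ((v, v') \<in> parcs G \<or> v = v' \<and> (u, u') \<in> parcs H)} \<rparr>"

definition complement_graph :: "'a pair_pre_digraph \<Rightarrow> 'a pair_pre_digraph" where
  "complement_graph G = \<lparr> pverts = pverts G,
     parcs = {(u, v). u \<in> pverts G \<and> v \<in> pverts G \<and> u \<noteq> v \<and> (u, v) \<notin> parcs G} \<rparr>"

definition path_graph :: "nat \<Rightarrow> nat pair_pre_digraph" where
  "path_graph n = \<lparr> pverts = {..<n},
     parcs = {(i, j). i < n \<and> j < n \<and> (j = i + 1 \<or> i = j + 1)} \<rparr>"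

text \<open>Only a cycle for \<open>n \<ge> 3\<close>.\<close>

definition cycle_graph :: "nat \<Rightarrow> nat pair_pre_digraph" where
  "cycle_graph n = \<lparr> pverts = {..<n},
     parcs = {(i, j). i < n \<and> j < n \<and> (j = (i + 1) mod n \<or> i = (j + 1) mod n)} \<rparr>"

text \<open>The \<open>i\<close>-th part, for \<open>1 \<le> i \<le> t\<close>, consists of the pairs \<open>(i, j)\<close> with \<open>j < ms i\<close>.\<close>

definition complete_multipartite :: "nat \<Rightarrow> (nat \<Rightarrow> nat) \<Rightarrow> (nat \<times> nat) pair_pre_digraph" where
  "complete_multipartite t ms = \<lparr> pverts = (SIGMA i:{1..t}. {..<ms i}),
     parcs = {(x, y). x \<in> (SIGMA i:{1..t}. {..<ms i}) \<and> y \<in> (SIGMA i:{1..t}. {..<ms i}) \<and>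
       fst x \<noteq> fst y} \<rparr>"

lemma pair_graphI:
  assumes "finite (pverts G)" "parcs G \<subseteq> pverts G \<times> pverts G"
    and "\<And>u. (u, u) \<notin> parcs G" "\<And>u v. (u, v) \<in> parcs G \<Longrightarrow> (v, u) \<in> parcs G"
  shows "pair_graph G"
proof
  show "finite (parcs G)"
    using assms(1,2) by (meson finite_SigmaI finite_subset)
  show "symmetric (with_proj G)"
    using assms(4) by (auto simp: symmetric_def intro: symI)
  show "fst e \<noteq> snd e" if "e \<in> parcs G" for e
    using assms(3) that by (cases e) auto
qed (use assms(1,2) in auto)

lemma pair_graph_path_graph: "pair_graph (path_graph n)"
  by (rule pair_graphI) (auto simp: path_graph_def)

lemma pair_graph_cycle_graph:
  assumes "n \<ge> 3"
  shows "pair_graph (cycle_graph n)"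
proof -
  have "i \<noteq> Suc i mod n" if "i < n" for i
    using assms that by (cases "Suc i = n") auto
  then show ?thesis
    by (intro pair_graphI) (auto simp: cycle_graph_def)
qed

lemma pair_graph_complete_multipartite: "pair_graph (complete_multipartite t ms)"
  by (rule pair_graphI) (auto simp: complete_multipartite_def)

lemma pair_graph_complement_graph:
  assumes "pair_graph G"
  shows "pair_graph (complement_graph G)"
proof -
  interpret pair_graph G by fact
  show ?thesis
    using pair_finite_verts
    by (intro pair_graphI) (auto simp: complement_graph_def dest: arcs_symmetric)
qed

lemma pair_graph_lex_product:
  assumes "pair_graph G" "pair_graph H"
  shows "pair_graph (lex_product G H)"
proof -
  interpret G: pair_graph G by fact
  interpret H: pair_graph H by fact
  show ?thesis
    using G.pair_finite_verts H.pair_finite_verts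
    by (intro pair_graphI)
      (auto simp: lex_product_def dest: G.arcs_symmetric H.arcs_symmetric G.no_loops' H.no_loops')
qed

end

theory Submission
  imports Defs
begin

text \<open>
  Regard \<open>G[H]\<close> as a union of fibres \<open>{v} \<times> V(H)\<close>. A vertex outside the fibre over \<open>v\<close> is
  equally far from all vertices of that fibre, whereas inside the fibre distances are exactly the
  adjacency codes of \<open>H\<close>, because a neighbour of \<open>v\<close> in \<open>G\<close> provides a common neighbour of any two
  of its vertices. So two vertices of one fibre can only be told apart from within that fibre, and
  each fibre of a resolving set of \<open>G[H]\<close> is an adjacency resolving set of \<open>H\<close>. Conversely, if
  \<open>S\<close> is adjacency resolving for \<open>H\<close>, then \<open>V(G) \<times> S\<close> separates vertices of the same fibre by
  definition, and vertices over \<open>v \<noteq> v'\<close> because \<open>v\<close> and \<open>v'\<close> are not twins: some third vertex is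
  adjacent to exactly one of them, and the fibre over it meets \<open>V(G) \<times> S\<close>. This is
  \<open>metric_dim_lex_product\<close>.

  What remains is to compute \<open>\<beta>\<^sub>2\<close>. A set \<open>W\<close> is adjacency resolving iff any two vertices outside
  \<open>W\<close> have different neighbourhoods in \<open>W\<close> (\<open>adj_resolving_set_iff\<close>); passing to the complement
  graph complements these neighbourhoods and changes nothing.

  For a graph with \<open>m\<close> vertices and maximum degree at most two, let \<open>k = |W|\<close>. Among the vertices
  outside \<open>W\<close>, at most one has no neighbour in \<open>W\<close> and at most \<open>k\<close> have exactly one, while at most \<open>2k\<close> edges leave \<open>W\<close>. Counting
  edges gives \<open>2m \<le> 5k + 2\<close>, so \<open>k \<ge> \<lfloor>(2m + 2) / 5\<rfloor>\<close>. For paths and cycles the bound is attained by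
  the vertices congruent to 1 or 3 modulo 5, with an adjustment in the last incomplete block of five.

  In a complete multipartite graph, adjacency depends on the parts only. Two omitted vertices must
  therefore lie in different parts, and no two omitted vertices can both come from singleton parts.
  Omitting one vertex of each part with at least two elements, and one singleton if there is any, is
  thus optimal.
\<close>

section \<open>Resolving sets\<close>

lemma inj_on_restrict_iff:
  "inj_on (\<lambda>v. restrict (f v) W) V \<longleftrightarrow>
     (\<forall>u\<in>V. \<forall>v\<in>V. u \<noteq> v \<longrightarrow> (\<exists>w\<in>W. f u w \<noteq> f v w))"
  unfolding inj_on_def restrict_def fun_eq_iff by metis

lemmas resolving_set_iff = resolving_set_def[unfolded inj_on_restrict_iff]

text \<open>
  Vertices of \<open>W\<close> are recognised by their entry 0, which occurs in no other code. For vertices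
  outside \<open>W\<close>, the code records the same information as the neighbourhood in \<open>W\<close>.
\<close>

lemma adj_resolving_set_iff:
  "adj_resolving_set H W \<longleftrightarrow> W \<subseteq> pverts H \<and>
     (\<forall>u\<in>pverts H - W. \<forall>v\<in>pverts H - W. u \<noteq> v \<longrightarrow>
        (\<exists>w\<in>W. ((u, w) \<in> parcs H) \<noteq> ((v, w) \<in> parcs H)))"
  (is "_ \<longleftrightarrow> ?R")
proof
  assume W: "adj_resolving_set H W"
  have "\<exists>w\<in>W. ((u, w) \<in> parcs H) \<noteq> ((v, w) \<in> parcs H)"
    if u: "u \<in> pverts H - W" and v: "v \<in> pverts H - W" and "u \<noteq> v" for u v
  proof -
    from W that obtain w where "w \<in> W" "adj_code H u w \<noteq> adj_code H v w"
      unfolding adj_resolving_set_def inj_on_restrict_iff by blast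
    with u v show ?thesis
      by (auto simp: adj_code_def split: if_splits)
  qed
  with W show ?R by (auto simp: adj_resolving_set_def)
next
  assume R: ?R
  have "\<exists>w\<in>W. adj_code H u w \<noteq> adj_code H v w"
    if u: "u \<in> pverts H" and v: "v \<in> pverts H" and "u \<noteq> v" for u v
  proof (cases "u \<in> W \<or> v \<in> W")
    case True
    have "adj_code H u u \<noteq> adj_code H v u" "adj_code H u v \<noteq> adj_code H v v"
      using \<open>u \<noteq> v\<close> by (auto simp: adj_code_def)
    with True show ?thesis by blast
  next
    case False
    with R that obtain w where "w \<in> W" "((u, w) \<in> parcs H) \<noteq> ((v, w) \<in> parcs H)"
      by blast
    moreover from this False have "adj_code H u w \<noteq> adj_code H v w"
      by (auto simp: adj_code_def)
    ultimately show ?thesis by blast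
  qed
  with R show "adj_resolving_set H W"
    unfolding adj_resolving_set_def inj_on_restrict_iff by blast
qed

lemma adj_metric_dim_attained:
  obtains W where "adj_resolving_set H W" "card W = adj_metric_dim H"
proof -
  have "adj_resolving_set H (pverts H)"
    by (auto simp: adj_resolving_set_iff)
  then have "\<exists>W. adj_resolving_set H W \<and> card W = adj_metric_dim H"
    unfolding adj_metric_dim_def
    using LeastI_ex[of "\<lambda>k. \<exists>W. adj_resolving_set H W \<and> card W = k"] by blast
  with that show ?thesis by blast
qed

lemma adj_metric_dim_le:
  "adj_resolving_set H W \<Longrightarrow> adj_metric_dim H \<le> card W"
  unfolding adj_metric_dim_def by (intro Least_le) blast

lemma adj_metric_dim_eqI:
  assumes "adj_resolving_set H W" "card W = k"
    and "\<And>W. adj_resolving_set H W \<Longrightarrow> k \<le> card W"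
  shows "adj_metric_dim H = k"
  using adj_metric_dim_attained[of H] adj_metric_dim_le[OF assms(1)] assms(2,3)
  by (metis le_antisym)

text \<open>
  For a vertex outside \<open>W\<close>, complementing the graph flips each adjacency to \<open>W\<close>, so the same pairs
  are separated.
\<close>

lemma adj_metric_dim_complement:
  "adj_metric_dim (complement_graph H) = adj_metric_dim H"
proof -
  have separates_iff: "(((u, w) \<in> parcs (complement_graph H)) \<noteq> ((v, w) \<in> parcs (complement_graph H)))
      = (((u, w) \<in> parcs H) \<noteq> ((v, w) \<in> parcs H))"
    if "W \<subseteq> pverts H" "u \<in> pverts H - W" "v \<in> pverts H - W" "w \<in> W" for u v w W
  proof -
    have "(x, w) \<in> parcs (complement_graph H) \<longleftrightarrow> (x, w) \<notin> parcs H" if "x \<in> pverts H - W" for x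
      using that \<open>w \<in> W\<close> \<open>W \<subseteq> pverts H\<close> by (auto simp: complement_graph_def)
    with that(2,3) show ?thesis by simp
  qed
  have "pverts (complement_graph H) = pverts H" by (simp add: complement_graph_def)
  then have "adj_resolving_set (complement_graph H) W \<longleftrightarrow> adj_resolving_set H W" for W
    unfolding adj_resolving_set_iff
    by (simp only:) (intro conj_cong ball_cong bex_cong imp_cong refl, rule separates_iff)
  then show ?thesis by (simp add: adj_metric_dim_def)
qed

section \<open>Distances\<close>

lemma gdist_eq_INF:
  assumes "pair_graph G"
  shows "gdist G u v = (INF p\<in>{p. pre_digraph.awalk (with_proj G) u p v}. ereal (real (length p)))"
proof -
  interpret pair_graph G by fact
  have "awalk_cost (\<lambda>_. 1) p = real (length p)" for p :: "('a \<times> 'a) list"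
    by (induct p) auto
  then show ?thesis
    by (simp add: gdist_def \<mu>_def)
qed

text \<open>
  The distance is an infimum of extended reals, infinite between different components; walk lengths
  are integers, so a bound on the distance is witnessed by an actual walk.
\<close>

lemma gdist_le_iff:
  assumes "pair_graph G"
  shows "gdist G u v \<le> ereal (real k) \<longleftrightarrow>
    (\<exists>p. pre_digraph.awalk (with_proj G) u p v \<and> length p \<le> k)" (is "_ \<longleftrightarrow> ?R")
proof
  assume le: "gdist G u v \<le> ereal (real k)"
  show ?R
  proof (rule ccontr)
    assume "\<not> ?R"
    then have "ereal (real (Suc k)) \<le> gdist G u v"
      unfolding gdist_eq_INF[OF assms] by (intro INF_greatest) force
    with le have "ereal (real (Suc k)) \<le> ereal (real k)" by (rule order_trans[rotated])
    then show False by simp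
  qed
next
  assume ?R
  then show "gdist G u v \<le> ereal (real k)"
    unfolding gdist_eq_INF[OF assms] by (auto intro: INF_lower2)
qed

lemma gdist_le_1_iff:
  assumes "pair_graph G" "u \<in> pverts G"
  shows "gdist G u v \<le> 1 \<longleftrightarrow> u = v \<or> (u, v) \<in> parcs G"
proof -
  interpret pair_graph G by fact
  have "gdist G u v \<le> 1 \<longleftrightarrow> (\<exists>p. awalk u p v \<and> length p \<le> 1)"
    using gdist_le_iff[OF assms(1), of u v 1] by (simp add: one_ereal_def)
  also have "\<dots> \<longleftrightarrow> u = v \<or> (u, v) \<in> parcs G"
  proof
    assume "\<exists>p. awalk u p v \<and> length p \<le> 1"
    then obtain p where "awalk u p v" "length p \<le> 1" by blast
    then show "u = v \<or> (u, v) \<in> parcs G"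
      by (cases p) (auto simp: awalk_simps)
  next
    assume "u = v \<or> (u, v) \<in> parcs G"
    then have "awalk u [] v \<or> awalk u [(u, v)] v"
      using assms(2) by (auto simp: awalk_simps dest: in_arcsD2)
    then show "\<exists>p. awalk u p v \<and> length p \<le> 1"
      using exI[of "\<lambda>p. awalk u p v \<and> length p \<le> 1" "[]"]
        exI[of "\<lambda>p. awalk u p v \<and> length p \<le> 1" "[(u, v)]"] by auto
  qed
  finally show ?thesis .
qed

text \<open>
  A common neighbour bounds the distance by 2, and distances up to 2 are what adjacency codes measure.
\<close>

lemma gdist_eq_adj_code:
  assumes "pair_graph G" and "(u, x) \<in> parcs G" "(x, v) \<in> parcs G"
  shows "gdist G u v = ereal (real (adj_code G u v))"
proof -
  interpret pair_graph G by fact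
  have u: "u \<in> pverts G" and v: "v \<in> pverts G"
    using assms(2,3) by (auto dest: in_arcsD1 in_arcsD2)
  have "adj_code G u v \<le> length p" if "awalk u p v" for p
  proof (cases p rule: remdups_adj.cases)
    case (3 e f q)
    then show ?thesis by (simp add: adj_code_def)
  qed (use that in \<open>auto simp: adj_code_def awalk_simps\<close>)
  then have ge: "ereal (real (adj_code G u v)) \<le> gdist G u v"
    unfolding gdist_eq_INF[OF assms(1)] by (intro INF_greatest) auto
  have "awalk u (if u = v then [] else if (u, v) \<in> parcs G then [(u, v)] else [(u, x), (x, v)]) v"
    using assms(2,3) u v by (auto simp: awalk_simps)
  then have "gdist G u v \<le> ereal (real (adj_code G u v))"
    unfolding gdist_le_iff[OF assms(1)]
    by (auto simp: adj_code_def intro!: exI split: if_splits)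
  with ge show ?thesis by (rule antisym[rotated])
qed

section \<open>Lexicographic products\<close>

lemma pverts_lex_product [simp]: "pverts (lex_product G H) = pverts G \<times> pverts H"
  by (simp add: lex_product_def)

lemma parcs_lex_product_iff [simp]:
  "((v, u), (v', u')) \<in> parcs (lex_product G H) \<longleftrightarrow>
     v \<in> pverts G \<and> u \<in> pverts H \<and> v' \<in> pverts G \<and> u' \<in> pverts H \<and>
     ((v, v') \<in> parcs G \<or> v = v' \<and> (u, u') \<in> parcs H)"
  by (simp add: lex_product_def)

text \<open>
  A walk from the fibre over \<open>v\<close> to another fibre has a first arc that leaves its fibre, and this arc
  may equally well start at any other vertex over \<open>v\<close>. Dropping what precedes it gives a walk from
  that vertex which is no longer than the original one.
\<close>

lemma gdist_lex_product_other_fibre: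
  assumes G: "pair_graph G" and H: "pair_graph H"
    and "v \<noteq> z" "u \<in> pverts H" "u' \<in> pverts H"
  shows "gdist (lex_product G H) (v, u) (z, s) = gdist (lex_product G H) (v, u') (z, s)"
proof -
  interpret pair_graph "lex_product G H"
    using G H by (rule pair_graph_lex_product)
  have shorter: "\<exists>q. awalk (v, u') q (z, s) \<and> length q \<le> length p"
    if "awalk (v, u) p (z, s)" "u' \<in> pverts H" for p u u'
    using that
  proof (induct p arbitrary: u)
    case Nil
    with \<open>v \<noteq> z\<close> show ?case by (simp add: awalk_simps)
  next
    case (Cons e p)
    then obtain v1 u1 where e: "e = ((v, u), (v1, u1))" "((v, u), (v1, u1)) \<in> parcs (lex_product G H)"
      and p: "awalk (v1, u1) p (z, s)"
      by (cases e) (auto simp: awalk_simps)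
    show ?case
    proof (cases "v1 = v")
      case True
      with Cons p obtain q where "awalk (v, u') q (z, s)" "length q \<le> length p" by blast
      then show ?thesis by (intro exI[of _ q]) auto
    next
      case False
      with e p \<open>u' \<in> pverts H\<close> have "awalk (v, u') (((v, u'), (v1, u1)) # p) (z, s)"
        by (auto simp: awalk_simps)
      then show ?thesis by (intro exI[of _ "((v, u'), (v1, u1)) # p"]) simp
    qed
  qed
  have "gdist (lex_product G H) (v, u') (z, s) \<le> gdist (lex_product G H) (v, u) (z, s)"
    if u': "u' \<in> pverts H" for u u'
    unfolding gdist_eq_INF[OF pair_graph_axioms]
  proof (rule INF_mono)
    fix p assume "p \<in> {p. awalk (v, u) p (z, s)}"
    then obtain q where "awalk (v, u') q (z, s)" "length q \<le> length p"
      using shorter u' by blast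
    then show "\<exists>q\<in>{q. awalk (v, u') q (z, s)}. ereal (real (length q)) \<le> ereal (real (length p))"
      by (intro bexI[of _ q]) auto
  qed
  with assms(4,5) show ?thesis by (blast intro: antisym)
qed

text \<open>Every vertex over a neighbour \<open>x\<close> of \<open>v\<close> is adjacent to the whole fibre over \<open>v\<close>.\<close>

lemma gdist_lex_product_same_fibre:
  assumes G: "pair_graph G" and H: "pair_graph H"
    and "(v, x) \<in> parcs G" "u \<in> pverts H" "s \<in> pverts H"
  shows "gdist (lex_product G H) (v, u) (v, s) = ereal (real (adj_code H u s))"
proof -
  interpret G: pair_graph G by fact
  have x: "(x, v) \<in> parcs G" and "v \<in> pverts G" "x \<in> pverts G"
    using assms(3) by (auto dest: G.in_arcsD1 G.in_arcsD2 G.arcs_symmetric)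
  then have "gdist (lex_product G H) (v, u) (v, s) =
      ereal (real (adj_code (lex_product G H) (v, u) (v, s)))"
    using assms by (intro gdist_eq_adj_code[of _ _ "(x, u)"] pair_graph_lex_product) auto
  moreover have "(v, v) \<notin> parcs G" using G.no_loops' by blast
  ultimately show ?thesis
    using assms \<open>v \<in> pverts G\<close> by (simp add: adj_code_def)
qed

text \<open>
  A neighbour of each vertex of \<open>G\<close> makes the distances inside a fibre agree with adjacency codes, so
  that resolving a fibre is a matter of \<open>H\<close> alone. The condition on \<open>|V(H)|\<close> forces adjacency
  resolving sets of \<open>H\<close> to be nonempty, so that every fibre of \<open>V(G) \<times> S\<close> can be used to separate
  other fibres.
\<close>

theorem metric_dim_lex_product:
  assumes G: "pair_graph G" and H: "pair_graph H"
    and no_twins: "\<nexists>u v. twins G u v"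
    and no_isolated: "\<And>v. v \<in> pverts G \<Longrightarrow> neighbors G v \<noteq> {}"
    and "card (pverts H) \<ge> 2"
  shows "metric_dim (lex_product G H) = card (pverts G) * adj_metric_dim H"
proof -
  interpret G: pair_graph G by fact
  interpret H: pair_graph H by fact
  let ?P = "lex_product G H"
  have P: "pair_graph ?P" using G H by (rule pair_graph_lex_product)
  have nbr: "\<exists>x. (v, x) \<in> parcs G" if "v \<in> pverts G" for v
    using no_isolated[OF that] by (auto simp: neighbors_def)
  obtain S where S: "adj_resolving_set H S" "card S = adj_metric_dim H"
    by (rule adj_metric_dim_attained)
  have "S \<noteq> {}"
  proof
    assume "S = {}"
    with S(1) have "\<forall>u\<in>pverts H. \<forall>v\<in>pverts H. u = v"
      by (auto simp: adj_resolving_set_iff)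
    then have "card (pverts H) \<le> 1"
      by (metis H.pair_finite_verts One_nat_def card_le_Suc0_iff_eq)
    with \<open>card (pverts H) \<ge> 2\<close> show False by simp
  qed
  then obtain s where s: "s \<in> S" by blast
  have SH: "S \<subseteq> pverts H" using S(1) by (simp add: adj_resolving_set_iff)
  \<comment> \<open>Since there are no loops, a vertex witnessing that \<open>v\<close> and \<open>v'\<close> are not twins is neither of them.\<close>
  have separated: "\<exists>z. z \<noteq> v \<and> z \<noteq> v' \<and> ((v, z) \<in> parcs G) \<noteq> ((v', z) \<in> parcs G)"
    if "v \<in> pverts G" "v' \<in> pverts G" "v \<noteq> v'" for v v'
  proof -
    have "neighbors G v' - {v} \<noteq> neighbors G v - {v'}"
      using no_twins that by (auto simp: twins_def)
    moreover have "(v, v) \<notin> parcs G" "(v', v') \<notin> parcs G"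
      using G.no_loops' by blast+
    ultimately show ?thesis
      by (auto simp: neighbors_def)
  qed
  have "resolving_set ?P (pverts G \<times> S)"
    unfolding resolving_set_iff
  proof (intro conjI ballI impI)
    show "pverts G \<times> S \<subseteq> pverts ?P" using SH by auto
  next
    fix a b assume a: "a \<in> pverts ?P" and b: "b \<in> pverts ?P" and "a \<noteq> b"
    obtain v u v' u' where ab: "a = (v, u)" "b = (v', u')"
      and mem: "v \<in> pverts G" "u \<in> pverts H" "v' \<in> pverts G" "u' \<in> pverts H"
      using a b by (cases a, cases b) auto
    show "\<exists>w\<in>pverts G \<times> S. gdist ?P a w \<noteq> gdist ?P b w"
    proof (cases "v = v'")
      case True
      with ab \<open>a \<noteq> b\<close> have "u \<noteq> u'" by simp
      with S(1) mem obtain w where w: "w \<in> S" "adj_code H u w \<noteq> adj_code H u' w"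
        unfolding adj_resolving_set_def inj_on_restrict_iff by blast
      obtain x where "(v, x) \<in> parcs G" using nbr mem by blast
      with w mem SH True ab have "gdist ?P a (v, w) \<noteq> gdist ?P b (v, w)"
        by (auto simp: gdist_lex_product_same_fibre[OF G H])
      with w mem show ?thesis by blast
    next
      case False
      then obtain z where z: "z \<noteq> v" "z \<noteq> v'" "((v, z) \<in> parcs G) \<noteq> ((v', z) \<in> parcs G)"
        using separated mem by blast
      then have zG: "z \<in> pverts G" by (auto dest: G.in_arcsD2)
      have "gdist ?P a (z, s) \<le> 1 \<longleftrightarrow> (v, z) \<in> parcs G" "gdist ?P b (z, s) \<le> 1 \<longleftrightarrow> (v', z) \<in> parcs G"
        using z(1,2) zG mem s SH ab by (auto simp: gdist_le_1_iff[OF P])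
      with z(3) have "gdist ?P a (z, s) \<noteq> gdist ?P b (z, s)" by auto
      with zG s show ?thesis by blast
    qed
  qed
  moreover have "card (pverts G \<times> S) = card (pverts G) * adj_metric_dim H"
    using S by (simp add: card_cartesian_product)
  moreover have "card (pverts G) * adj_metric_dim H \<le> card W" if W: "resolving_set ?P W" for W
  proof -
    define F where "F v = {u. (v, u) \<in> W}" for v
    have WP: "W \<subseteq> pverts G \<times> pverts H" using W by (simp add: resolving_set_iff)
    have "adj_resolving_set H (F v)" if v: "v \<in> pverts G" for v
      unfolding adj_resolving_set_def inj_on_restrict_iff
    proof (intro conjI ballI impI)
      show "F v \<subseteq> pverts H" using WP by (auto simp: F_def)
    next
      fix u u' assume u: "u \<in> pverts H" "u' \<in> pverts H" "u \<noteq> u'"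
      have "(v, u) \<in> pverts ?P" "(v, u') \<in> pverts ?P" "(v, u) \<noteq> (v, u')"
        using u v by auto
      with W obtain w where "w \<in> W" "gdist ?P (v, u) w \<noteq> gdist ?P (v, u') w"
        unfolding resolving_set_iff by blast
      then obtain z t where w: "(z, t) \<in> W"
          "gdist ?P (v, u) (z, t) \<noteq> gdist ?P (v, u') (z, t)"
        by (cases w) auto
      then have "z = v"
        using gdist_lex_product_other_fibre[OF G H, of v z u u'] u by blast
      moreover obtain x where "(v, x) \<in> parcs G" using nbr v by blast
      ultimately have "adj_code H u t \<noteq> adj_code H u' t"
        using w u WP gdist_lex_product_same_fibre[OF G H, of v x] by auto
      with w \<open>z = v\<close> show "\<exists>w\<in>F v. adj_code H u w \<noteq> adj_code H u' w"
        by (auto simp: F_def)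
    qed
    then have "(\<Sum>v\<in>pverts G. adj_metric_dim H) \<le> (\<Sum>v\<in>pverts G. card (F v))"
      by (intro sum_mono adj_metric_dim_le)
    also have "\<dots> = card (SIGMA v:pverts G. F v)"
    proof (rule card_SigmaI[symmetric])
      have "F v \<subseteq> pverts H" for v using WP by (auto simp: F_def)
      then show "\<forall>v\<in>pverts G. finite (F v)"
        using H.pair_finite_verts finite_subset by blast
    qed (rule G.pair_finite_verts)
    also have "(SIGMA v:pverts G. F v) = W"
      using WP by (auto simp: F_def)
    finally show ?thesis by simp
  qed
  ultimately show ?thesis
    unfolding metric_dim_def by (intro Least_equality) auto
qed

section \<open>Paths and cycles\<close>

text \<open>
  Double counting of the arcs between \<open>W\<close> and its complement \<open>U\<close>. The vertices of \<open>U\<close> have distinct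
  neighbourhoods in \<open>W\<close>, so at most one neighbourhood is empty and at most \<open>|W|\<close> are singletons.
\<close>

lemma card_le_adj_resolving_set_degree_two:
  assumes "pair_graph H" and deg: "\<And>v. v \<in> pverts H \<Longrightarrow> card (neighbors H v) \<le> 2"
    and W: "adj_resolving_set H W"
  shows "2 * card (pverts H) \<le> 5 * card W + 2"
proof -
  interpret pair_graph H by fact
  define U where "U = pverts H - W"
  define f where "f u = neighbors H u \<inter> W" for u
  have WV: "W \<subseteq> pverts H" using W by (simp add: adj_resolving_set_iff)
  have fin: "finite W" "finite U"
    using finite_subset[OF WV pair_finite_verts] pair_finite_verts by (simp_all add: U_def)
  have inj: "inj_on f U"
    using W unfolding inj_on_def f_def U_def adj_resolving_set_iff neighbors_def by blast
  have "card {u\<in>U. f u = {}} \<le> card {{} :: 'a set}"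
    by (rule card_inj_on_le[of f]) (use inj in \<open>auto intro: inj_on_subset\<close>)
  then have U0: "card {u\<in>U. f u = {}} \<le> 1" by simp
  have "card {u\<in>U. card (f u) = 1} \<le> card ((\<lambda>w. {w}) ` W)"
    by (rule card_inj_on_le[of f])
      (use inj fin in \<open>auto intro: inj_on_subset simp: card_1_singleton_iff f_def\<close>)
  also have "\<dots> \<le> card W" using fin by (simp add: card_image_le)
  finally have U1: "card {u\<in>U. card (f u) = 1} \<le> card W" .
  have "(\<Sum>u\<in>U. card (f u)) = (\<Sum>u\<in>U. card {w\<in>W. (u, w) \<in> parcs H})"
    by (intro sum.cong arg_cong[of _ _ card]) (auto simp: f_def neighbors_def)
  also have "\<dots> = (\<Sum>w\<in>W. card {u\<in>U. (u, w) \<in> parcs H})"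
    unfolding card_eq_sum by (rule sum.swap_restrict[OF fin(2,1)])
  also have "\<dots> \<le> (\<Sum>w\<in>W. 2)"
  proof (rule sum_mono)
    fix w assume "w \<in> W"
    have "{u\<in>U. (u, w) \<in> parcs H} \<subseteq> neighbors H w" "finite (neighbors H w)"
      using finite_subset[OF _ pair_finite_verts, of "neighbors H w"]
      by (auto simp: neighbors_def dest: arcs_symmetric in_arcsD2)
    then have "card {u\<in>U. (u, w) \<in> parcs H} \<le> card (neighbors H w)"
      by (rule card_mono[rotated])
    also have "\<dots> \<le> 2" using deg \<open>w \<in> W\<close> WV by blast
    finally show "card {u\<in>U. (u, w) \<in> parcs H} \<le> 2" .
  qed
  finally have edges: "(\<Sum>u\<in>U. card (f u)) \<le> 2 * card W" by simp
  \<comment> \<open>A vertex of \<open>U\<close> sends at least two arcs to \<open>W\<close> or falls short by one or two; the correction terms add these.\<close>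
  have "2 * card U = (\<Sum>u\<in>U. 2)" by simp
  also have "\<dots> \<le> (\<Sum>u\<in>U. card (f u) + of_bool (card (f u) = 1) + 2 * of_bool (f u = {}))"
  proof (rule sum_mono)
    fix u assume "u \<in> U"
    have "finite (f u)" using fin by (simp add: f_def)
    then have "card (f u) = 0 \<longleftrightarrow> f u = {}" by simp
    then show "2 \<le> card (f u) + of_bool (card (f u) = 1) + 2 * of_bool (f u = {})"
      by (cases "card (f u) = 0"; cases "card (f u) = 1") auto
  qed
  also have "\<dots> = (\<Sum>u\<in>U. card (f u)) + card {u\<in>U. card (f u) = 1} + 2 * card {u\<in>U. f u = {}}"
    using fin by (simp add: sum.distrib Int_def flip: sum_distrib_left)
  also have "\<dots> \<le> 3 * card W + 2" using edges U0 U1 by simp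
  finally have "2 * card U \<le> 3 * card W + 2" .
  moreover have "card (pverts H) = card U + card W"
    using WV fin pair_finite_verts by (simp add: U_def card_Diff_subset card_mono)
  ultimately show ?thesis by simp
qed

text \<open>
  Paths and cycles are treated together by leaving open whether the first and the last vertex are
  adjacent.
\<close>

locale path_like = pair_graph H for H :: "nat pair_pre_digraph" and m :: nat +
  assumes m_ge_4: "4 \<le> m"
    and verts_eq: "pverts H = {..<m}"
    and consecutive: "Suc i < m \<Longrightarrow> (i, Suc i) \<in> parcs H"
    and arc_cases: "(i, j) \<in> parcs H \<Longrightarrow>
      j = Suc i \<or> i = Suc j \<or> i = 0 \<and> j = m - 1 \<or> i = m - 1 \<and> j = 0"
begin

lemma interior_arc_iff:
  assumes "0 < w" "Suc w < m"
  shows "(u, w) \<in> parcs H \<longleftrightarrow> u = Suc w \<or> w = Suc u"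
  using assms arc_cases[of u w] consecutive[of u] consecutive[of w]
    arcs_symmetric[of w u] arcs_symmetric[of u w] by (auto dest: arcs_symmetric)

lemma card_neighbors_le: "card (neighbors H v) \<le> 2"
proof -
  have "neighbors H v \<subseteq>
      (if v = 0 then {1, m - 1} else if v = m - 1 then {m - 2, 0} else {v - 1, Suc v})"
    using arc_cases m_ge_4 verts_eq in_arcsD2 by (fastforce simp: neighbors_def)
  then have "card (neighbors H v) \<le>
      card (if v = 0 then {1, m - 1} else if v = m - 1 then {m - 2, 0} else {v - 1, Suc v})"
    by (rule card_mono[rotated]) simp
  also have "\<dots> \<le> 2" by (simp add: card_insert_if)
  finally show ?thesis .
qed

text \<open>
  In a complete block of five consecutive vertices, the chosen positions 1 and 3 give the positions
  0, 2 and 4 the neighbourhoods {1}, {1, 3} and {3}. An incomplete last block of \<open>r < 5\<close> vertices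
  contributes its last \<open>r div 2\<close> vertices. For \<open>r \<ge> 3\<close> two vertices of that block stay outside the
  set, and only the second of them is adjacent to the first chosen vertex of the block.
\<close>

definition pattern :: "nat set" where
  "pattern = (\<lambda>k. 5 * k + 1) ` {..<m div 5} \<union> (\<lambda>k. 5 * k + 3) ` {..<m div 5} \<union>
     {m - m mod 5 div 2..<m}"

lemma card_pattern: "card pattern = (2 * m + 2) div 5"
proof -
  define q r where "q = m div 5" and "r = m mod 5"
  have m: "m = 5 * q + r" and "r < 5" by (simp_all add: q_def r_def)
  have "r div 2 \<le> r" by simp
  with m have le: "5 * q \<le> m - r div 2" "r div 2 \<le> m" by linarith+
  let ?A = "(\<lambda>k. 5 * k + 1) ` {..<q}" and ?B = "(\<lambda>k. 5 * k + 3) ` {..<q}"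
  have "?A \<inter> ?B = {}" by auto presburger
  moreover have "(?A \<union> ?B) \<inter> {m - r div 2..<m} = {}" using le(1) by auto
  ultimately have "card pattern = card ?A + card ?B + card {m - r div 2..<m}"
    unfolding pattern_def q_def[symmetric] r_def[symmetric]
    by (subst card_Un_disjoint; simp add: card_Un_disjoint)+
  also have "\<dots> = 2 * q + r div 2"
    using le(2) by (simp add: card_image inj_on_def)
  also have "r div 2 = (2 * r + 2) div 5"
  proof -
    from \<open>r < 5\<close> consider "r = 0" | "r = 1" | "r = 2" | "r = 3" | "r = 4" by linarith
    then show ?thesis by cases simp_all
  qed
  also have "2 * q + (2 * r + 2) div 5 = (2 * r + 2 + 5 * (2 * q)) div 5"
    by (subst div_mult_self2) simp_all
  also have "2 * r + 2 + 5 * (2 * q) = 2 * m + 2" by (simp add: m)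
  finally show ?thesis .
qed

lemma adj_resolving_set_pattern: "adj_resolving_set H pattern"
proof -
  define q r where "q = m div 5" and "r = m mod 5"
  have m: "m = 5 * q + r" and "r < 5" by (simp_all add: q_def r_def)
  \<comment> \<open>The vertices chosen in complete blocks are neither first nor last, so a closing arc does not
    affect them.\<close>
  have block: "5 * k + 1 \<in> pattern" "5 * k + 3 \<in> pattern"
      "(x, 5 * k + 1) \<in> parcs H \<longleftrightarrow> x = 5 * k \<or> x = 5 * k + 2"
      "(x, 5 * k + 3) \<in> parcs H \<longleftrightarrow> x = 5 * k + 2 \<or> x = 5 * k + 4"
    if "k < q" for k x
  proof -
    show "5 * k + 1 \<in> pattern" "5 * k + 3 \<in> pattern"
      using that by (auto simp: pattern_def q_def)
    show "(x, 5 * k + 1) \<in> parcs H \<longleftrightarrow> x = 5 * k \<or> x = 5 * k + 2"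
      using that m interior_arc_iff[of "5 * k + 1" x] by auto
    show "(x, 5 * k + 3) \<in> parcs H \<longleftrightarrow> x = 5 * k + 2 \<or> x = 5 * k + 4"
      using that m interior_arc_iff[of "5 * k + 3" x] by auto
  qed
  have ex: "\<exists>w\<in>pattern. ((u, w) \<in> parcs H) \<noteq> ((v, w) \<in> parcs H)"
    if "u < v" "v < m" and u: "u \<notin> pattern" and v: "v \<notin> pattern" for u v
  proof (cases "u < 5 * q")
    case True
    define k where "k = u div 5"
    have k: "k < q" using True by (simp add: k_def less_mult_imp_div_less mult.commute)
    have "u = 5 * k + u mod 5" "u mod 5 < 5" by (simp_all add: k_def)
    moreover have "u \<noteq> 5 * k + 1" "u \<noteq> 5 * k + 3" using u block(1,2)[OF k] by auto
    ultimately consider "u = 5 * k" | "u = 5 * k + 2" | "u = 5 * k + 4" by linarith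
    then show ?thesis
    proof cases
      case 1
      show ?thesis
      proof (cases "v = 5 * k + 2")
        case True
        \<comment> \<open>Both vertices are adjacent to position 1, and only \<open>v\<close> is adjacent to position 3.\<close>
        with 1 have "((u, 5 * k + 3) \<in> parcs H) \<noteq> ((v, 5 * k + 3) \<in> parcs H)"
          using block(4)[OF k] by simp
        with block(2)[OF k] show ?thesis by blast
      next
        case False
        with 1 have "((u, 5 * k + 1) \<in> parcs H) \<noteq> ((v, 5 * k + 1) \<in> parcs H)"
          using block(3)[OF k] \<open>u < v\<close> by auto
        with block(1)[OF k] show ?thesis by blast
      qed
    next
      case 2
      then have "((u, 5 * k + 1) \<in> parcs H) \<noteq> ((v, 5 * k + 1) \<in> parcs H)"
        using block(3)[OF k] \<open>u < v\<close> by auto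
      with block(1)[OF k] show ?thesis by blast
    next
      case 3
      then have "((u, 5 * k + 3) \<in> parcs H) \<noteq> ((v, 5 * k + 3) \<in> parcs H)"
        using block(4)[OF k] \<open>u < v\<close> by auto
      with block(2)[OF k] show ?thesis by blast
    qed
  next
    case False
    \<comment> \<open>Two unchosen vertices in the incomplete block exist only for \<open>r \<ge> 3\<close>, and are its first two.\<close>
    have v_less: "v < m - r div 2" using v \<open>v < m\<close> by (auto simp: pattern_def r_def)
    from \<open>r < 5\<close> consider "r = 0" | "r = 1" | "r = 2" | "r = 3" | "r = 4"
      by linarith
    then have "u = 5 * q \<and> v = 5 * q + 1 \<and> m - r div 2 \<le> 5 * q + 2 \<and> 5 * q + 2 < m"
      using v_less \<open>u < v\<close> False m by cases auto
    then have uv: "u = 5 * q" "v = 5 * q + 1" "m - r div 2 \<le> 5 * q + 2" "5 * q + 2 < m"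
      by blast+
    then have "5 * q + 2 \<in> pattern" by (simp add: pattern_def r_def)
    moreover have "(v, 5 * q + 2) \<in> parcs H"
      using consecutive[of v] uv by simp
    moreover have "(u, 5 * q + 2) \<notin> parcs H"
      using arc_cases[of u "5 * q + 2"] uv m_ge_4 by auto
    ultimately show ?thesis by blast
  qed
  have "\<exists>w\<in>pattern. ((u, w) \<in> parcs H) \<noteq> ((v, w) \<in> parcs H)"
    if "u \<in> pverts H - pattern" "v \<in> pverts H - pattern" "u \<noteq> v" for u v
    using ex[of u v] ex[of v u] that by (auto simp: verts_eq neq_iff)
  moreover have "pattern \<subseteq> pverts H"
    by (auto simp: verts_eq pattern_def)
  ultimately show ?thesis by (auto simp: adj_resolving_set_iff)
qed

lemma adj_metric_dim_eq: "adj_metric_dim H = (2 * m + 2) div 5"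
proof (rule adj_metric_dim_eqI[OF adj_resolving_set_pattern card_pattern])
  fix W assume "adj_resolving_set H W"
  then have "2 * m \<le> 5 * card W + 2"
    using card_le_adj_resolving_set_degree_two[OF pair_graph_axioms card_neighbors_le]
    by (simp add: verts_eq)
  then show "(2 * m + 2) div 5 \<le> card W" by linarith
qed

end

lemma path_like_path_graph: "4 \<le> m \<Longrightarrow> path_like (path_graph m) m"
  by (intro path_like.intro path_like_axioms.intro pair_graph_path_graph)
    (auto simp: path_graph_def)

lemma path_like_cycle_graph: "4 \<le> m \<Longrightarrow> path_like (cycle_graph m) m"
proof (intro path_like.intro path_like_axioms.intro pair_graph_cycle_graph)
  fix i j assume "(i, j) \<in> parcs (cycle_graph m)"
  then show "j = Suc i \<or> i = Suc j \<or> i = 0 \<and> j = m - 1 \<or> i = m - 1 \<and> j = 0"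
    by (auto simp: cycle_graph_def mod_Suc split: if_splits)
qed (auto simp: cycle_graph_def)

text \<open>
  A third vertex adjacent to exactly one of \<open>u < v\<close> is found next to one of them. The cycle of order
  4, where opposite vertices are twins, is excluded by the bounds on \<open>n\<close>.
\<close>

lemma no_twins_path_or_cycle:
  assumes "(n \<ge> 4 \<and> G = path_graph n) \<or> (n \<ge> 5 \<and> G = cycle_graph n)"
  shows "\<nexists>u v. twins G u v"
proof -
  interpret path_like G n
    using assms path_like_path_graph path_like_cycle_graph by auto
  have wrap: "n \<ge> 5" if "(0, n - 1) \<in> parcs G \<or> (n - 1, 0) \<in> parcs G"
    using assms that by (auto simp: path_graph_def)
  have no_twins: "\<not> twins G u v" if "u < v" for u v
  proof
    assume tw: "twins G u v"
    then have "v < n" by (simp add: twins_def verts_eq)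
    have eq: "(v, x) \<in> parcs G \<longleftrightarrow> (u, x) \<in> parcs G" if "x \<noteq> u" "x \<noteq> v" for x
      using tw that by (auto simp: twins_def neighbors_def)
    have up: "(x, Suc x) \<in> parcs G" "(Suc x, x) \<in> parcs G" if "Suc x < n" for x
      using consecutive[OF that] arcs_symmetric by auto
    show False
    \<comment> \<open>Adjacent \<open>u\<close> and \<open>v\<close> are separated by their outer neighbours. Otherwise \<open>v - 1\<close> separates them
      unless it is also next to \<open>u\<close>, and at distance two an outer neighbour works again, where only a
      closing arc in a cycle of order 4 could interfere.\<close>
    proof (cases "v = Suc u")
      case True
      consider "Suc v < n" | "Suc v = n" using \<open>v < n\<close> by linarith
      then show False
      proof cases
        case 1
        then show False
          using True up[of v] eq[of "Suc v"] arc_cases[of u "Suc v"] m_ge_4 by auto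
      next
        case 2
        then obtain k where "u = Suc k" using True m_ge_4 by (cases u) auto
        then show False
          using 2 True up[of k] eq[of k] arc_cases[of v k] m_ge_4 by auto
      qed
    next
      case False
      then have v: "v = Suc (Suc u)"
        using \<open>u < v\<close> \<open>v < n\<close> up[of "v - 1"] eq[of "v - 1"] arc_cases[of u "v - 1"]
        by auto
      show False
      proof (cases u)
        case 0
        then show False
          using v up[of v] eq[of "Suc v"] arc_cases[of u "Suc v"] m_ge_4 wrap by auto
      next
        case (Suc k)
        then show False
          using v \<open>v < n\<close> up[of k] eq[of k] arc_cases[of v k] m_ge_4 wrap by auto
      qed
    qed
  qed
  then show ?thesis
    by (metis nat_neq_iff twins_def)
qed

section \<open>Complete multipartite graphs\<close>

text \<open>
  Sort the vertices into classes, one for each of the \<open>r\<close> parts of size at least two, and one, present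
  iff \<open>r < t\<close>, for all singleton parts together. Two vertices of the same class are separated by
  themselves only, so at most one of them can be left out. There are \<open>min t (r + 1)\<close> classes.
\<close>

lemma adj_metric_dim_complete_multipartite:
  assumes "r \<le> t" and large: "\<forall>i\<in>{1..r}. 2 \<le> ms i" and single: "\<forall>i\<in>{r+1..t}. ms i = 1"
  shows "adj_metric_dim (complete_multipartite t ms) = (\<Sum>i=1..t. ms i) - min t (r + 1)"
proof -
  let ?K = "complete_multipartite t ms"
  let ?V = "SIGMA i:{1..t}. {..<ms i}"
  let ?R = "{1..min t (r + 1)}"
  have V: "pverts ?K = ?V" by (simp add: complete_multipartite_def)
  have arc: "(x, y) \<in> parcs ?K \<longleftrightarrow> x \<in> ?V \<and> y \<in> ?V \<and> fst x \<noteq> fst y" for x y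
    by (auto simp: complete_multipartite_def)
  have card_V: "card ?V = (\<Sum>i=1..t. ms i)" by simp
  have fin: "finite ?V" by simp
  have pos: "0 < ms i" if "i \<in> {1..t}" for i
    using bspec[OF large, of i] bspec[OF single, of i] that by (cases "i \<le> r") auto
  define U where "U = (\<lambda>i. (i, 0::nat)) ` ?R"
  have U: "U \<subseteq> ?V" using pos by (auto simp: U_def)
  have "card U = min t (r + 1)" by (simp add: U_def card_image inj_on_def)
  with U have card_W: "card (?V - U) = (\<Sum>i=1..t. ms i) - min t (r + 1)"
    using fin card_V by (simp add: card_Diff_subset finite_subset)
  \<comment> \<open>The smaller of two parts meeting \<open>U\<close> is among the first \<open>r\<close>, so it has a second vertex, and that
    one is not in \<open>U\<close>.\<close>
  have ex: "\<exists>w\<in>?V - U. ((u, w) \<in> parcs ?K) \<noteq> ((v, w) \<in> parcs ?K)"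
    if "u \<in> U" "v \<in> U" "fst u < fst v" for u v
  proof (rule bexI[of _ "(fst u, 1)"])
    from that have "fst u \<in> {1..r}" by (auto simp: U_def)
    with large \<open>r \<le> t\<close> show w: "(fst u, 1) \<in> ?V - U" by (fastforce simp: U_def)
    with that U show "((u, (fst u, 1)) \<in> parcs ?K) \<noteq> ((v, (fst u, 1)) \<in> parcs ?K)"
      by (auto simp: arc)
  qed
  have "adj_resolving_set ?K (?V - U)"
    unfolding adj_resolving_set_iff V
  proof (intro conjI ballI impI)
    fix u v assume "u \<in> ?V - (?V - U)" "v \<in> ?V - (?V - U)" "u \<noteq> v"
    then have "u \<in> U" "v \<in> U" "fst u < fst v \<or> fst v < fst u"
      by (auto simp: U_def)
    then show "\<exists>w\<in>?V - U. ((u, w) \<in> parcs ?K) \<noteq> ((v, w) \<in> parcs ?K)"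
      using ex[of u v] ex[of v u] by auto
  qed auto
  then show ?thesis
    using card_W
  proof (rule adj_metric_dim_eqI)
    fix W assume W: "adj_resolving_set ?K W"
    then have WV: "W \<subseteq> ?V" by (simp add: adj_resolving_set_iff V)
    \<comment> \<open>The map \<open>x \<mapsto> min (fst x) (r + 1)\<close> numbers the classes, merging all singleton parts.\<close>
    have "inj_on (\<lambda>x. min (fst x) (r + 1)) (?V - W)"
    proof (rule inj_onI, rule ccontr)
      fix u v assume u: "u \<in> ?V - W" and v: "v \<in> ?V - W"
        and eq: "min (fst u) (r + 1) = min (fst v) (r + 1)" and "u \<noteq> v"
      have "\<exists>w\<in>W. ((u, w) \<in> parcs ?K) \<noteq> ((v, w) \<in> parcs ?K)"
        using W[unfolded adj_resolving_set_iff V, THEN conjunct2, rule_format, OF u v \<open>u \<noteq> v\<close>] .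
      then obtain w where "w \<in> W" and sep: "((u, w) \<in> parcs ?K) \<noteq> ((v, w) \<in> parcs ?K)"
        by blast
      have "w \<in> ?V" using WV \<open>w \<in> W\<close> by (rule subsetD)
      with sep u v have "(fst u \<noteq> fst w) \<noteq> (fst v \<noteq> fst w)"
        unfolding arc by simp
      note w = \<open>w \<in> W\<close> \<open>w \<in> ?V\<close> this
      have beyond: "fst u > r" "fst v > r" using w(3) eq by (auto simp: min_def split: if_splits)
      have unique: "x = y" if "x \<in> ?V" "y \<in> ?V" "fst x = fst y" "fst x > r" for x y
      proof -
        have "ms (fst x) = 1" using single that(1,4) by (auto simp: mem_Sigma_iff)
        with that(1-3) show ?thesis by (cases x; cases y) auto
      qed
      from w(3) have "fst u = fst w \<or> fst v = fst w" by blast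
      then have "u = w \<or> v = w" using unique u v w(2) beyond by blast
      with w u v show False by auto
    qed
    moreover have "(\<lambda>x. min (fst x) (r + 1)) ` (?V - W) \<subseteq> ?R" by auto
    ultimately have "card (?V - W) \<le> card ?R" by (rule card_inj_on_le) simp
    moreover have "card (?V - W) = card ?V - card W"
      using WV fin by (simp add: card_Diff_subset finite_subset)
    ultimately show "(\<Sum>i=1..t. ms i) - min t (r + 1) \<le> card W"
      unfolding card_V card_atLeastAtMost by linarith
  qed
qed

theorem corollary2:
  fixes n :: nat and G :: "nat pair_pre_digraph"
  assumes "(n \<ge> 4 \<and> G = path_graph n) \<or> (n \<ge> 5 \<and> G = cycle_graph n)"
  shows
    "(\<nexists>u v. twins G u v) \<and>
     (\<forall>H :: 'b pair_pre_digraph. pair_graph H \<and> card (pverts H) \<ge> 2 \<longrightarrow>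
        metric_dim (lex_product G H) = n * adj_metric_dim H) \<and>
     (\<forall>m::nat. m \<ge> 4 \<longrightarrow>
        adj_metric_dim (path_graph m) = (2 * m + 2) div 5 \<and>
        adj_metric_dim (cycle_graph m) = (2 * m + 2) div 5 \<and>
        adj_metric_dim (complement_graph (path_graph m)) = (2 * m + 2) div 5 \<and>
        adj_metric_dim (complement_graph (cycle_graph m)) = (2 * m + 2) div 5 \<and>
        metric_dim (lex_product G (path_graph m)) = n * ((2 * m + 2) div 5) \<and>
        metric_dim (lex_product G (cycle_graph m)) = n * ((2 * m + 2) div 5) \<and>
        metric_dim (lex_product G (complement_graph (path_graph m))) = n * ((2 * m + 2) div 5) \<and>
        metric_dim (lex_product G (complement_graph (cycle_graph m))) = n * ((2 * m + 2) div 5)) \<and>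
     (\<forall>(t::nat) (r::nat) (ms :: nat \<Rightarrow> nat) (m::nat).
        r \<le> t \<and> (\<forall>i\<in>{1..r}. ms i \<ge> 2) \<and> (\<forall>i\<in>{r+1..t}. ms i = 1) \<and>
        m = (\<Sum>i=1..t. ms i) \<and> m \<ge> 2 \<longrightarrow>
        metric_dim (lex_product G (complement_graph (complete_multipartite t ms))) =
          (if r \<noteq> t then n * (m - r - 1) else n * (m - r)) \<and>
        metric_dim (lex_product G (complete_multipartite t ms)) =
          (if r \<noteq> t then n * (m - r - 1) else n * (m - r)))"
proof -
  interpret G: path_like G n
    using assms path_like_path_graph path_like_cycle_graph by auto
  have no_twins: "\<nexists>u v. twins G u v"
    by (rule no_twins_path_or_cycle[OF assms])
  have "neighbors G v \<noteq> {}" if "v \<in> pverts G" for v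
    using that G.consecutive[of v] G.consecutive[of "v - 1"] G.m_ge_4 G.arcs_symmetric
    by (cases "v = 0") (auto simp: neighbors_def G.verts_eq)
  then have lex: "metric_dim (lex_product G H) = n * adj_metric_dim H"
    if "pair_graph H" "card (pverts H) \<ge> 2" for H :: "'c pair_pre_digraph"
    using metric_dim_lex_product[OF G.pair_graph_axioms that(1) no_twins _ that(2)]
    by (simp add: G.verts_eq)
  have complement: "adj_metric_dim (complement_graph H) = adj_metric_dim H"
      "metric_dim (lex_product G (complement_graph H)) = n * adj_metric_dim H"
    if "pair_graph H" "card (pverts H) \<ge> 2" for H :: "'c pair_pre_digraph"
  proof -
    show "adj_metric_dim (complement_graph H) = adj_metric_dim H"
      by (rule adj_metric_dim_complement)
    moreover have "pverts (complement_graph H) = pverts H" by (simp add: complement_graph_def)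
    ultimately show "metric_dim (lex_product G (complement_graph H)) = n * adj_metric_dim H"
      using lex[OF pair_graph_complement_graph[OF that(1)]] that(2) by simp
  qed
  show ?thesis
  proof (intro conjI allI impI no_twins)
    fix H :: "'b pair_pre_digraph" assume "pair_graph H \<and> 2 \<le> card (pverts H)"
    then show "metric_dim (lex_product G H) = n * adj_metric_dim H" using lex by blast
  next
    fix m :: nat assume m: "4 \<le> m"
    interpret P: path_like "path_graph m" m by (rule path_like_path_graph[OF m])
    interpret C: path_like "cycle_graph m" m by (rule path_like_cycle_graph[OF m])
    note P = P.pair_graph_axioms and C = C.pair_graph_axioms
    have two: "2 \<le> card (pverts (path_graph m))" "2 \<le> card (pverts (cycle_graph m))"
      using m by (simp_all add: P.verts_eq C.verts_eq)
    note beta = P.adj_metric_dim_eq C.adj_metric_dim_eq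
    show "adj_metric_dim (path_graph m) = (2 * m + 2) div 5"
      "adj_metric_dim (cycle_graph m) = (2 * m + 2) div 5"
      by (fact beta)+
    show "adj_metric_dim (complement_graph (path_graph m)) = (2 * m + 2) div 5"
      "adj_metric_dim (complement_graph (cycle_graph m)) = (2 * m + 2) div 5"
      "metric_dim (lex_product G (path_graph m)) = n * ((2 * m + 2) div 5)"
      "metric_dim (lex_product G (cycle_graph m)) = n * ((2 * m + 2) div 5)"
      "metric_dim (lex_product G (complement_graph (path_graph m))) = n * ((2 * m + 2) div 5)"
      "metric_dim (lex_product G (complement_graph (cycle_graph m))) = n * ((2 * m + 2) div 5)"
      using complement[OF P two(1)] complement[OF C two(2)] lex[OF P two(1)] lex[OF C two(2)]
      unfolding beta by blast+
  next
    fix t r :: nat and ms :: "nat \<Rightarrow> nat" and m :: nat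
    assume parts: "r \<le> t \<and> (\<forall>i\<in>{1..r}. ms i \<ge> 2) \<and> (\<forall>i\<in>{r+1..t}. ms i = 1) \<and>
      m = (\<Sum>i=1..t. ms i) \<and> m \<ge> 2"
    let ?K = "complete_multipartite t ms"
    have two: "2 \<le> card (pverts ?K)"
      using parts by (simp add: complete_multipartite_def)
    have "adj_metric_dim ?K = m - min t (r + 1)"
      using parts adj_metric_dim_complete_multipartite[of r t ms] by simp
    also have "\<dots> = (if r \<noteq> t then m - r - 1 else m - r)"
      using parts by (auto simp: min_def)
    finally have beta: "n * adj_metric_dim ?K =
        (if r \<noteq> t then n * (m - r - 1) else n * (m - r))"
      by simp
    show "metric_dim (lex_product G (complement_graph ?K)) =
        (if r \<noteq> t then n * (m - r - 1) else n * (m - r))"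
      using complement(2)[OF pair_graph_complete_multipartite two] beta by simp
    show "metric_dim (lex_product G ?K) = (if r \<noteq> t then n * (m - r - 1) else n * (m - r))"
      using lex[OF pair_graph_complete_multipartite two] beta by simp
  qed
qed

end
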